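(* Let $\delta>0$, let $(X,d,\mu)$ be an Ahlfors $\delta$-regular metric-measure space and let $\Delta$ be its logarithmic Dirichlet Laplacian on $L^2(X,\mu)$. Let $h$ be a Dini continuous function on $(X,d)$. Then the multiplication operator $m_hf=hf$ maps $\operatorname{Dom}\Delta$ into $\operatorname{Dom}\Delta$, and the commutator $[\Delta,m_h]=\Delta m_h-m_h\Delta:\operatorname{Dom}\Delta\to L^2(X,\mu)$ extends to the bounded operator $K_h:L^2(X,\mu)\to L^2(X,\mu)$ given by $$K_hf(x)=\int_X\frac{h(x)-h(y)}{d(x,y)^\delta}f(y)\,d\mu(y).$$
   Context: A metric-measure space is a triple $(X,d,\mu)$ where $(X,d)$ is a locally compact second-countable metric space and $\mu$ is a finite Borel measure on $X$. It is Ahlfors $\delta$-regular ($\delta>0$) if there is $C\ge 1$ such that $C^{-1}r^\delta\le\mu(\overline B(x,r))\le Cr^\delta$ for all $x\in X$ and $0\le r<\operatorname{diam}X$; then $\operatorname{diam} X<\infty$. $L^2(X,\mu)$ denotes the real Hilbert space of real-valued square-integrable functions. Define $$\operatorname{Dom}\mathcal E=\Big\{f\in L^2(X,\mu):\int_X\int_X\frac{|f(x)-f(y)|^2}{d(x,y)^\delta}\,d\mu(y)\,d\mu(x)<\infty\Big\},$$ $$\mathcal E(f,g)=\frac12\int_X\int_X\frac{(f(x)-f(y))(g(x)-g(y))}{d(x,y)^\delta}\,d\mu(y)\,d\mu(x),\qquad f,g\in\operatorname{Dom}\mathcal E,$$ the integrals being over the complement of the diagonal in $X\times X$ (and similarly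 the integral defining $K_h f(x)$ is over $X\setminus\{x\}$). This is a densely defined closed form. The logarithmic Dirichlet Laplacian $\Delta$ is the positive self-adjoint operator associated with $\mathcal E$: if $R:L^2(X,\mu)\to\operatorname{Dom}\mathcal E$ is determined by $\langle Rf,g\rangle_{L^2}+\mathcal E(Rf,g)=\langle f,g\rangle_{L^2}$ for all $g\in\operatorname{Dom}\mathcal E$, then $\operatorname{Dom}\Delta=R(L^2(X,\mu))$ and $\Delta Rf=f-Rf$. Thus $R=(1+\Delta)^{-1}$, $\operatorname{Dom}\mathcal E=\operatorname{Dom}\Delta^{1/2}$ and $\mathcal E(f,g)=\langle\Delta^{1/2}f,\Delta^{1/2}g\rangle_{L^2}$. A bounded uniformly continuous function $h:X\to\mathbb R$ is Dini continuous if $\int_0^1\frac{\omega_h(t)}{t}\,dt<\infty$, where $\omega_h(t)=\sup\{|h(x)-h(y)|:d(x,y)\le t\operatorname{diam}(X)\}$ for $t\in[0,1]$. *)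

theory Defs
  imports "HOL-Analysis.Analysis"
begin

text \<open>The metric space $X$ is the whole type, and second countability is a type class assumption.\<close>

definition metric_measure_space ::
  "'a::{metric_space, second_countable_topology} measure \<Rightarrow> bool" where
  "metric_measure_space \<mu> \<longleftrightarrow>
     locally_compact_space (euclidean :: 'a topology) \<and> sets \<mu> = sets borel \<and> finite_measure \<mu>"

text \<open>The condition on \<open>y\<close> and \<open>z\<close> says $r < \operatorname{diam} X$ with the diameter taken in
  $[0,\infty]$; the library's real-valued \<^const>\<open>diameter\<close> is meaningful only for bounded sets.\<close>

definition ahlfors_regular ::
  "real \<Rightarrow> 'a::{metric_space, second_countable_topology} measure \<Rightarrow> bool" where
  "ahlfors_regular \<delta> \<mu> \<longleftrightarrow>
     (\<exists>C\<ge>1. \<forall>x r. 0 \<le> r \<and> (\<exists>y z::'a. r < dist y z) \<longrightarrow>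
        r powr \<delta> / C \<le> measure \<mu> (cball x r) \<and> measure \<mu> (cball x r) \<le> C * r powr \<delta>)"

text \<open>Elements of $L^2(X,\mu)$ are represented by functions. Equality in $L^2$ is equality almost
  everywhere, and an operator is a map on representatives, determined up to null sets.\<close>

definition L2_fun :: "'a measure \<Rightarrow> ('a \<Rightarrow> real) set" where
  "L2_fun \<mu> = {f \<in> borel_measurable \<mu>. integrable \<mu> (\<lambda>x. (f x)\<^sup>2)}"

definition L2_inner :: "'a measure \<Rightarrow> ('a \<Rightarrow> real) \<Rightarrow> ('a \<Rightarrow> real) \<Rightarrow> real" where
  "L2_inner \<mu> f g = (LINT x|\<mu>. f x * g x)"

definition L2_fun_norm :: "'a measure \<Rightarrow> ('a \<Rightarrow> real) \<Rightarrow> real" where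
  "L2_fun_norm \<mu> f = sqrt (L2_inner \<mu> f f)"

definition bounded_L2_operator :: "'a measure \<Rightarrow> (('a \<Rightarrow> real) \<Rightarrow> 'a \<Rightarrow> real) \<Rightarrow> bool" where
  "bounded_L2_operator \<mu> T \<longleftrightarrow>
     (\<forall>f\<in>L2_fun \<mu>. T f \<in> L2_fun \<mu>) \<and>
     (\<forall>f\<in>L2_fun \<mu>. \<forall>g\<in>L2_fun \<mu>. (AE x in \<mu>. f x = g x) \<longrightarrow> (AE x in \<mu>. T f x = T g x)) \<and>
     (\<forall>f\<in>L2_fun \<mu>. \<forall>g\<in>L2_fun \<mu>. \<forall>a b.
        AE x in \<mu>. T (\<lambda>y. a * f y + b * g y) x = a * T f x + b * T g x) \<and>
     (\<exists>B. \<forall>f\<in>L2_fun \<mu>. L2_fun_norm \<mu> (T f) \<le> B * L2_fun_norm \<mu> f)"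

definition dom_energy :: "real \<Rightarrow> 'a::metric_space measure \<Rightarrow> ('a \<Rightarrow> real) set" where
  "dom_energy \<delta> \<mu> = {f \<in> L2_fun \<mu>.
     (\<integral>\<^sup>+ x. (\<integral>\<^sup>+ y\<in>-{x}. ennreal (\<bar>f x - f y\<bar>\<^sup>2 / dist x y powr \<delta>) \<partial>\<mu>) \<partial>\<mu>) < \<infinity>}"

definition energy ::
  "real \<Rightarrow> 'a::metric_space measure \<Rightarrow> ('a \<Rightarrow> real) \<Rightarrow> ('a \<Rightarrow> real) \<Rightarrow> real" where
  "energy \<delta> \<mu> f g =
     1/2 * (LINT x|\<mu>. (LINT y:-{x}|\<mu>. (f x - f y) * (g x - g y) / dist x y powr \<delta>))"

text \<open>\<open>is_resolvent \<delta> \<mu> f u\<close> says that $u = Rf = (1 + \Delta)^{-1} f$.\<close>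

definition is_resolvent ::
  "real \<Rightarrow> 'a::metric_space measure \<Rightarrow> ('a \<Rightarrow> real) \<Rightarrow> ('a \<Rightarrow> real) \<Rightarrow> bool" where
  "is_resolvent \<delta> \<mu> f u \<longleftrightarrow> u \<in> dom_energy \<delta> \<mu> \<and>
     (\<forall>g\<in>dom_energy \<delta> \<mu>. L2_inner \<mu> u g + energy \<delta> \<mu> u g = L2_inner \<mu> f g)"

definition dom_log_laplacian :: "real \<Rightarrow> 'a::metric_space measure \<Rightarrow> ('a \<Rightarrow> real) set" where
  "dom_log_laplacian \<delta> \<mu> = {u. \<exists>f\<in>L2_fun \<mu>. is_resolvent \<delta> \<mu> f u}"

text \<open>$\Delta u = f - u$ for $u = Rf$. On \<^const>\<open>dom_log_laplacian\<close>, density of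
  \<^const>\<open>dom_energy\<close> in $L^2$ makes the chosen \<open>f\<close> unique up to null sets.\<close>

definition log_laplacian ::
  "real \<Rightarrow> 'a::metric_space measure \<Rightarrow> ('a \<Rightarrow> real) \<Rightarrow> 'a \<Rightarrow> real" where
  "log_laplacian \<delta> \<mu> u =
     (\<lambda>x. (SOME f. f \<in> L2_fun \<mu> \<and> is_resolvent \<delta> \<mu> f u) x - u x)"

text \<open>Ahlfors regularity of a finite measure forces $\operatorname{diam} X < \infty$, so in its
  presence \<^const>\<open>diameter\<close> is the true diameter. The supremum is over a nonempty set, bounded for
  bounded \<open>h\<close>.\<close>

definition modulus_cont :: "('a::metric_space \<Rightarrow> real) \<Rightarrow> real \<Rightarrow> real" where
  "modulus_cont h t = Sup {\<bar>h x - h y\<bar> | x y. dist x y \<le> t * diameter (UNIV :: 'a set)}"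

definition dini_continuous :: "('a::metric_space \<Rightarrow> real) \<Rightarrow> bool" where
  "dini_continuous h \<longleftrightarrow>
     bounded (range h) \<and> uniformly_continuous_on UNIV h \<and>
     (\<integral>\<^sup>+ t\<in>{0<..1}. ennreal (modulus_cont h t / t) \<partial>lborel) < \<infinity>"

definition mult_op :: "('a \<Rightarrow> real) \<Rightarrow> ('a \<Rightarrow> real) \<Rightarrow> 'a \<Rightarrow> real" where
  "mult_op h f = (\<lambda>x. h x * f x)"

definition commutator ::
  "(('a \<Rightarrow> real) \<Rightarrow> 'a \<Rightarrow> real) \<Rightarrow> (('a \<Rightarrow> real) \<Rightarrow> 'a \<Rightarrow> real) \<Rightarrow> ('a \<Rightarrow> real) \<Rightarrow> 'a \<Rightarrow> real" where
  "commutator A B f = (\<lambda>x. A (B f) x - B (A f) x)"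

definition K_op ::
  "real \<Rightarrow> 'a::metric_space measure \<Rightarrow> ('a \<Rightarrow> real) \<Rightarrow> ('a \<Rightarrow> real) \<Rightarrow> 'a \<Rightarrow> real" where
  "K_op \<delta> \<mu> h f = (\<lambda>x. LINT y:-{x}|\<mu>. (h x - h y) / dist x y powr \<delta> * f y)"

end

theory Submission
  imports Defs
begin

text \<open>Write \<open>k(x, y) = (h x - h y) / d(x, y)\<^sup>\<delta>\<close>, an antisymmetric kernel.  Two facts carry the proof.

  First, \<open>\<integral> \<bar>k(x, y)\<bar> d\<mu>(y)\<close> is bounded uniformly in \<open>x\<close>
  (\<open>dini_kernel_row_bound\<close>).  Writing the singularity as an integral over radii of indicators
  of balls, and using the upper regularity \<open>\<mu>(B(x, r)) \<le> C r\<^sup>\<delta>\<close>, one is left with exactly the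
  Dini integral of \<open>h\<close>.  As \<open>\<bar>k\<bar>\<close> is symmetric, a one-sided Schur test gives the boundedness of
  \<open>K\<^sub>h\<close> on \<open>L\<^sup>2\<close>, and absolute convergence of \<open>\<integral>\<integral> k(x, y) f(y) v(x)\<close>
  (\<open>bounded_kernel_op\<close>, \<open>integrable_kernel_pairing\<close>).

  Second, an algebraic identity for differences, together with the antisymmetry of \<open>k\<close>, gives
  \<open>E(h f, v) = E(f, h v) + \<langle>K\<^sub>h f, v\<rangle>\<close> for \<open>f\<close> and \<open>v\<close> in the domain of the energy, which
  is stable under multiplication by \<open>h\<close> (\<open>energy_dini_mult\<close>, \<open>dom_energy_dini_mult\<close>).  If
  \<open>f = R g\<close>, testing the defining equation of \<open>R g\<close> against \<open>h v\<close> turns this into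
  \<open>h f = R (h g + K\<^sub>h f)\<close> (\<open>resolvent_dini_mult\<close>).  Hence \<open>h f\<close> lies in the domain of \<open>\<Delta>\<close>, and
  \<open>\<Delta> (h f) - h \<Delta> f = (h g + K\<^sub>h f - h f) - h (g - f) = K\<^sub>h f\<close>.

  To read off \<open>\<Delta>\<close> from such an equation, the source \<open>g\<close> of \<open>u = R g\<close> must be determined by \<open>u\<close> up
  to null sets.  The energy domain contains all bounded Lipschitz functions, again by the kernel
  bound, and these separate integrable functions (\<open>AE_zero_if_orthogonal_to_Lipschitz\<close>).\<close>

section \<open>Square-integrable functions\<close>

lemma abs_mult_le_squares: "\<bar>a * b\<bar> \<le> a\<^sup>2 + b\<^sup>2" for a b :: real
  using sum_squares_bound[of "\<bar>a\<bar>" "\<bar>b\<bar>"] mult_nonneg_nonneg[of "\<bar>a\<bar>" "\<bar>b\<bar>"]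
  unfolding abs_mult power2_abs by linarith

lemma L2_funI:
  "f \<in> borel_measurable M \<Longrightarrow> integrable M (\<lambda>x. (f x)\<^sup>2) \<Longrightarrow> f \<in> L2_fun M"
  by (simp add: L2_fun_def)

lemma L2_fun_measurable [measurable_dest]: "f \<in> L2_fun M \<Longrightarrow> f \<in> borel_measurable M"
  by (simp add: L2_fun_def)

lemma L2_fun_square: "f \<in> L2_fun M \<Longrightarrow> integrable M (\<lambda>x. (f x)\<^sup>2)"
  by (simp add: L2_fun_def)

lemma L2_fun_mult_integrable:
  assumes "f \<in> L2_fun M" "g \<in> L2_fun M"
  shows "integrable M (\<lambda>x. f x * g x)"
proof (rule Bochner_Integration.integrable_bound)
  show "integrable M (\<lambda>x. (f x)\<^sup>2 + (g x)\<^sup>2)"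
    using assms by (simp add: L2_fun_square)
  show "AE x in M. norm (f x * g x) \<le> norm ((f x)\<^sup>2 + (g x)\<^sup>2)"
    by (simp add: abs_mult_le_squares)
qed (use assms in measurable)

lemma L2_fun_add:
  assumes "f \<in> L2_fun M" "g \<in> L2_fun M"
  shows "(\<lambda>x. f x + g x) \<in> L2_fun M"
proof (rule L2_funI)
  show "integrable M (\<lambda>x. (f x + g x)\<^sup>2)"
    unfolding power2_sum mult.assoc
    by (intro Bochner_Integration.integrable_add integrable_mult_right L2_fun_square
        L2_fun_mult_integrable assms)
qed (use assms in measurable)

lemma L2_fun_bounded_mult:
  assumes [measurable]: "h \<in> borel_measurable M" and h: "\<And>x. \<bar>h x\<bar> \<le> H" and f: "f \<in> L2_fun M"
  shows "(\<lambda>x. h x * f x) \<in> L2_fun M"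
proof (rule L2_funI)
  show "integrable M (\<lambda>x. (h x * f x)\<^sup>2)"
  proof (rule Bochner_Integration.integrable_bound)
    show "integrable M (\<lambda>x. H\<^sup>2 * (f x)\<^sup>2)" using f by (simp add: L2_fun_square)
    show "AE x in M. norm ((h x * f x)\<^sup>2) \<le> norm (H\<^sup>2 * (f x)\<^sup>2)"
      using h by (auto simp: power_mult_distrib intro!: mult_right_mono abs_le_square_iff[THEN iffD1] order_trans[OF h])
  qed (use f in measurable)
qed (use f in measurable)

lemma (in finite_measure) bounded_in_L2_fun:
  assumes [measurable]: "h \<in> borel_measurable M" and h: "\<And>x. \<bar>h x\<bar> \<le> H"
  shows "h \<in> L2_fun M"
proof -
  have "(\<lambda>x. 1) \<in> L2_fun M" by (simp add: L2_fun_def)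
  from L2_fun_bounded_mult[OF assms this] show ?thesis by simp
qed

section \<open>Lipschitz functions detect null functions\<close>

text \<open>For nonempty \<open>A\<close> the functions \<open>max 0 (1 - n d(x, A))\<close> are Lipschitz and decrease to the indicator of a
  closed set \<open>A\<close>; closed sets form a \<open>\<pi>\<close>-system generating the Borel sets.\<close>

lemma AE_zero_if_orthogonal_to_Lipschitz:
  fixes F :: "'a::metric_space \<Rightarrow> real"
  assumes "finite_measure M" and sets: "sets M = sets borel" and F: "integrable M F"
    and orth: "\<And>v L. L-lipschitz_on UNIV v \<Longrightarrow> (\<And>x. 0 \<le> v x \<and> v x \<le> 1)
      \<Longrightarrow> (LINT x|M. F x * v x) = 0"
  shows "AE x in M. F x = 0"
proof -
  interpret finite_measure M by fact
  have sp: "space M = UNIV" using sets sets_eq_imp_space_eq by fastforce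
  have Fm [measurable]: "F \<in> borel_measurable M" using F by auto
  have closed0: "(LINT x:A|M. F x) = 0" if A: "closed A" for A
  proof (cases "A = {}")
    case False
    define v where "v n x = max 0 (1 - real n * infdist x A)" for n x
    have lip: "(real n)-lipschitz_on UNIV (v n)" for n
    proof (rule lipschitz_onI)
      fix x y :: 'a
      have "\<bar>infdist x A - infdist y A\<bar> \<le> dist x y"
        using infdist_triangle_abs[of x A y] by simp
      then have "real n * \<bar>infdist x A - infdist y A\<bar> \<le> real n * dist x y"
        by (intro mult_left_mono) auto
      then have "\<bar>real n * infdist x A - real n * infdist y A\<bar> \<le> real n * dist x y"
        by (simp add: abs_mult flip: right_diff_distrib)
      then show "dist (v n x) (v n y) \<le> real n * dist x y"
        unfolding v_def dist_real_def by (smt (verit))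
    qed auto
    have vm [measurable]: "v n \<in> borel_measurable M" for n
    proof -
      have "v n \<in> borel_measurable borel"
        using lipschitz_on_continuous_on[OF lip] by (rule borel_measurable_continuous_onI)
      then show ?thesis using measurable_cong_sets[OF sets refl] by blast
    qed
    have v01: "0 \<le> v n x \<and> v n x \<le> 1" for n x
      by (simp add: v_def infdist_nonneg)
    have [measurable]: "A \<in> sets M" using sets A by auto
    have "(\<lambda>n. LINT x|M. F x * v n x) \<longlonglongrightarrow> (LINT x|M. F x * indicator A x)"
    proof (rule integral_dominated_convergence)
      show "integrable M (\<lambda>x. norm (F x))" using F by simp
      show "AE x in M. (\<lambda>n. F x * v n x) \<longlonglongrightarrow> F x * indicator A x"
      proof (intro AE_I2 tendsto_mult tendsto_const)
        fix x
        show "(\<lambda>n. v n x) \<longlonglongrightarrow> indicator A x"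
        proof (cases "x \<in> A")
          case True then show ?thesis by (simp add: v_def)
        next
          case False
          then have "infdist x A > 0"
            using A \<open>A \<noteq> {}\<close> by (simp add: infdist_pos_not_in_closed)
          then obtain N where N: "1 < real N * infdist x A"
            using reals_Archimedean3 by blast
          have "v n x = 0" if "n \<ge> N" for n
          proof -
            have "real N * infdist x A \<le> real n * infdist x A"
              using that by (intro mult_right_mono) (auto simp: infdist_nonneg)
            then show ?thesis using N by (simp add: v_def)
          qed
          then have "eventually (\<lambda>n. v n x = 0) sequentially"
            using eventually_sequentially by blast
          then show ?thesis using False by (simp add: tendsto_eventually)
        qed
      qed
      show "AE x in M. norm (F x * v n x) \<le> norm (F x)" for n
        using v01[of n] by (auto simp: abs_mult intro!: mult_left_le)
    qed measurable
    moreover have "(LINT x|M. F x * v n x) = 0" for n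
      by (rule orth[OF lip v01])
    ultimately have "(LINT x|M. F x * indicator A x) = 0"
      by (simp add: LIMSEQ_const_iff)
    then show ?thesis by (simp add: set_lebesgue_integral_def mult.commute)
  qed (simp add: set_lebesgue_integral_def)
  have "(LINT x:A|M. F x) = 0" if "A \<in> sets M" for A
  proof -
    have gen: "sets M = sigma_sets UNIV (Collect closed)"
      by (simp add: sets borel_eq_closed)
    have int: "set_integrable M B F" if "B \<in> sets M" for B
      using F that integrable_mult_indicator set_integrable_def by blast
    have "Int_stable (Collect (closed :: 'a set \<Rightarrow> bool))"
      by (auto simp: Int_stable_def)
    moreover have "Collect closed \<subseteq> Pow (UNIV :: 'a set)" by simp
    moreover have "A \<in> sigma_sets UNIV (Collect closed)" using that gen by simp
    ultimately show ?thesis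
    proof (induction rule: sigma_sets_induct_disjoint)
      case (compl A)
      then have A: "A \<in> sets M" by (simp add: gen)
      have "UNIV - A \<in> sets M" using A sets.compl_sets[OF A] sp by simp
      then have "(LINT x:A \<union> (UNIV - A)|M. F x) = (LINT x:A|M. F x) + (LINT x:UNIV - A|M. F x)"
        using A by (intro set_integral_Un int) auto
      moreover have "(LINT x:A \<union> (UNIV - A)|M. F x) = 0"
        using closed0[of UNIV] by simp
      ultimately show ?case using compl by simp
    next
      case (union A)
      then have A: "\<And>i. A i \<in> sets M" by (auto simp: gen)
      have "(LINT x:(\<Union>i. A i)|M. F x) = (\<Sum>i. (LINT x:A i|M. F x))"
        using union A by (intro lebesgue_integral_countable_add int) (auto simp: disjoint_family_on_def)
      then show ?case using union by simp
    qed (auto simp: closed0)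
  qed
  then show ?thesis by (rule density_zero[OF F])
qed

section \<open>A symmetric Schur test\<close>

text \<open>A bound on the rows of \<open>k\<close> is also one on the columns, because \<open>\<bar>k\<bar>\<close> is symmetric; the
  operator norm on \<open>L\<^sup>2\<close> is then at most \<open>B\<close>.\<close>

locale schur_kernel = finite_measure M for M :: "'a measure" +
  fixes k :: "'a \<Rightarrow> 'a \<Rightarrow> real" and B :: real
  assumes kernel_measurable [measurable]: "(\<lambda>(x, y). k x y) \<in> borel_measurable (M \<Otimes>\<^sub>M M)"
    and abs_kernel_sym: "\<bar>k x y\<bar> = \<bar>k y x\<bar>"
    and bound_nonneg: "0 \<le> B"
    and row_bound: "x \<in> space M \<Longrightarrow> (\<integral>\<^sup>+y. ennreal \<bar>k x y\<bar> \<partial>M) \<le> ennreal B"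
begin

sublocale pair: pair_sigma_finite M M ..

lemma row_measurable [measurable]: "x \<in> space M \<Longrightarrow> k x \<in> borel_measurable M"
  using measurable_Pair2[OF kernel_measurable] by simp

lemma nn_integral_kernel_mult_fst:
  assumes [measurable]: "g \<in> borel_measurable M"
  shows "(\<integral>\<^sup>+x. (\<integral>\<^sup>+y. ennreal \<bar>k x y\<bar> * g x \<partial>M) \<partial>M) \<le> ennreal B * (\<integral>\<^sup>+x. g x \<partial>M)"
proof -
  have "(\<integral>\<^sup>+x. (\<integral>\<^sup>+y. ennreal \<bar>k x y\<bar> * g x \<partial>M) \<partial>M)
      = (\<integral>\<^sup>+x. (\<integral>\<^sup>+y. ennreal \<bar>k x y\<bar> \<partial>M) * g x \<partial>M)"
    by (intro nn_integral_cong nn_integral_multc) measurable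
  also have "\<dots> \<le> (\<integral>\<^sup>+x. ennreal B * g x \<partial>M)"
    by (intro nn_integral_mono mult_right_mono row_bound) auto
  also have "\<dots> = ennreal B * (\<integral>\<^sup>+x. g x \<partial>M)"
    by (rule nn_integral_cmult) measurable
  finally show ?thesis .
qed

lemma nn_integral_kernel_mult_snd:
  assumes [measurable]: "g \<in> borel_measurable M"
  shows "(\<integral>\<^sup>+x. (\<integral>\<^sup>+y. ennreal \<bar>k x y\<bar> * g y \<partial>M) \<partial>M) \<le> ennreal B * (\<integral>\<^sup>+x. g x \<partial>M)"
proof -
  have "(\<integral>\<^sup>+x. (\<integral>\<^sup>+y. ennreal \<bar>k x y\<bar> * g y \<partial>M) \<partial>M)
      = (\<integral>\<^sup>+y. (\<integral>\<^sup>+x. ennreal \<bar>k x y\<bar> * g y \<partial>M) \<partial>M)"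
    by (rule pair.Fubini'[symmetric]) measurable
  then show ?thesis
    using nn_integral_kernel_mult_fst[OF assms] by (simp add: abs_kernel_sym)
qed

text \<open>The integrand is dominated by \<open>\<bar>k(x, y)\<bar> (f(y)\<^sup>2 + v(x)\<^sup>2)\<close>; the first summand is
  controlled by the columns of \<open>k\<close>, the second by its rows.\<close>

lemma integrable_kernel_pairing:
  assumes f: "f \<in> L2_fun M" and v: "v \<in> L2_fun M"
  shows "integrable (M \<Otimes>\<^sub>M M) (\<lambda>(x, y). k x y * f y * v x)"
proof (rule integrableI_bounded)
  have [measurable]: "f \<in> borel_measurable M" "v \<in> borel_measurable M"
    using f v by measurable
  show "(\<lambda>(x, y). k x y * f y * v x) \<in> borel_measurable (M \<Otimes>\<^sub>M M)" by measurable
  have pt: "ennreal \<bar>k x y * f y * v x\<bar>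
      \<le> ennreal \<bar>k x y\<bar> * ennreal ((f y)\<^sup>2) + ennreal \<bar>k x y\<bar> * ennreal ((v x)\<^sup>2)" for x y
  proof -
    have "\<bar>f y * v x\<bar> \<le> (f y)\<^sup>2 + (v x)\<^sup>2"
      by (rule abs_mult_le_squares)
    then have "\<bar>k x y\<bar> * \<bar>f y * v x\<bar> \<le> \<bar>k x y\<bar> * ((f y)\<^sup>2 + (v x)\<^sup>2)"
      by (rule mult_left_mono) simp
    then show ?thesis
      by (simp add: abs_mult mult.assoc distrib_left flip: ennreal_mult' ennreal_plus)
  qed
  have "(\<integral>\<^sup>+p. ennreal (norm (case p of (x, y) \<Rightarrow> k x y * f y * v x)) \<partial>(M \<Otimes>\<^sub>M M))
      = (\<integral>\<^sup>+x. (\<integral>\<^sup>+y. ennreal \<bar>k x y * f y * v x\<bar> \<partial>M) \<partial>M)"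
    by (subst nn_integral_fst[symmetric]) auto
  also have "\<dots> \<le> (\<integral>\<^sup>+x. (\<integral>\<^sup>+y. ennreal \<bar>k x y\<bar> * ennreal ((f y)\<^sup>2)
      + ennreal \<bar>k x y\<bar> * ennreal ((v x)\<^sup>2) \<partial>M) \<partial>M)"
    by (intro nn_integral_mono pt)
  also have "\<dots> = (\<integral>\<^sup>+x. (\<integral>\<^sup>+y. ennreal \<bar>k x y\<bar> * ennreal ((f y)\<^sup>2) \<partial>M)
      + (\<integral>\<^sup>+y. ennreal \<bar>k x y\<bar> * ennreal ((v x)\<^sup>2) \<partial>M) \<partial>M)"
    by (intro nn_integral_cong nn_integral_add) measurable
  also have "\<dots> = (\<integral>\<^sup>+x. (\<integral>\<^sup>+y. ennreal \<bar>k x y\<bar> * ennreal ((f y)\<^sup>2) \<partial>M) \<partial>M)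
      + (\<integral>\<^sup>+x. (\<integral>\<^sup>+y. ennreal \<bar>k x y\<bar> * ennreal ((v x)\<^sup>2) \<partial>M) \<partial>M)"
    by (intro nn_integral_add) measurable
  also have "\<dots> \<le> ennreal B * (\<integral>\<^sup>+x. ennreal ((f x)\<^sup>2) \<partial>M)
      + ennreal B * (\<integral>\<^sup>+x. ennreal ((v x)\<^sup>2) \<partial>M)"
    by (intro add_mono nn_integral_kernel_mult_fst nn_integral_kernel_mult_snd) measurable
  also have "\<dots> < \<infinity>"
    using f v by (simp add: L2_fun_square nn_integral_eq_integral ennreal_mult_less_top)
  finally show "(\<integral>\<^sup>+p. ennreal (norm (case p of (x, y) \<Rightarrow> k x y * f y * v x)) \<partial>(M \<Otimes>\<^sub>M M)) < \<infinity>" .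
qed

lemma AE_integrable_kernel:
  assumes "f \<in> L2_fun M"
  shows "AE x in M. integrable M (\<lambda>y. k x y * f y)"
proof -
  have "(\<lambda>x. 1) \<in> L2_fun M" by (rule bounded_in_L2_fun[where H = 1]) auto
  from pair.AE_integrable_fst[OF integrable_kernel_pairing[OF assms this]] show ?thesis by simp
qed

definition kernel_op :: "('a \<Rightarrow> real) \<Rightarrow> 'a \<Rightarrow> real" where
  "kernel_op f x = (LINT y|M. k x y * f y)"

lemma kernel_op_measurable [measurable]:
  assumes [measurable]: "f \<in> borel_measurable M"
  shows "kernel_op f \<in> borel_measurable M"
  unfolding kernel_op_def[abs_def] by measurable

text \<open>Cauchy--Schwarz for the weight \<open>\<bar>k x y\<bar>\<close>, whose total mass in \<open>y\<close> is at most \<open>B\<close>.\<close>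

lemma kernel_op_square_le:
  assumes [measurable]: "f \<in> borel_measurable M" and x: "x \<in> space M"
  shows "ennreal ((kernel_op f x)\<^sup>2) \<le> ennreal B * (\<integral>\<^sup>+y. ennreal \<bar>k x y\<bar> * ennreal ((f y)\<^sup>2) \<partial>M)"
proof -
  have [measurable]: "k x \<in> borel_measurable M" using x by measurable
  let ?p = "\<lambda>y. ennreal (sqrt \<bar>k x y\<bar>)" and ?q = "\<lambda>y. ennreal (sqrt \<bar>k x y\<bar> * \<bar>f y\<bar>)"
  have "ennreal \<bar>kernel_op f x\<bar> \<le> (\<integral>\<^sup>+y. ennreal \<bar>k x y * f y\<bar> \<partial>M)"
  proof (cases "integrable M (\<lambda>y. k x y * f y)")
    case True
    from integral_norm_bound_ennreal[OF this] show ?thesis by (simp add: kernel_op_def)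
  next
    case False
    then show ?thesis by (simp add: kernel_op_def not_integrable_integral_eq)
  qed
  also have "\<dots> = (\<integral>\<^sup>+y. ?p y * ?q y \<partial>M)"
    by (intro nn_integral_cong) (simp add: abs_mult flip: ennreal_mult' mult.assoc)
  finally have "(ennreal \<bar>kernel_op f x\<bar>)\<^sup>2 \<le> (\<integral>\<^sup>+y. ?p y * ?q y \<partial>M)\<^sup>2"
    by (rule power_mono) simp
  also have "\<dots> \<le> (\<integral>\<^sup>+y. (?p y)\<^sup>2 \<partial>M) * (\<integral>\<^sup>+y. (?q y)\<^sup>2 \<partial>M)"
    by (rule Cauchy_Schwarz_nn_integral) measurable
  also have "(\<lambda>y. (?p y)\<^sup>2) = (\<lambda>y. ennreal \<bar>k x y\<bar>)"
    by (simp add: ennreal_power)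
  also have "(\<lambda>y. (?q y)\<^sup>2) = (\<lambda>y. ennreal \<bar>k x y\<bar> * ennreal ((f y)\<^sup>2))"
    by (simp add: ennreal_power power_mult_distrib flip: ennreal_mult')
  also have "(\<integral>\<^sup>+y. ennreal \<bar>k x y\<bar> \<partial>M) * (\<integral>\<^sup>+y. ennreal \<bar>k x y\<bar> * ennreal ((f y)\<^sup>2) \<partial>M)
      \<le> ennreal B * (\<integral>\<^sup>+y. ennreal \<bar>k x y\<bar> * ennreal ((f y)\<^sup>2) \<partial>M)"
    by (intro mult_right_mono row_bound x) simp
  finally show ?thesis by (simp add: ennreal_power)
qed

lemma nn_integral_kernel_op_square_le:
  assumes f: "f \<in> L2_fun M"
  shows "(\<integral>\<^sup>+x. ennreal ((kernel_op f x)\<^sup>2) \<partial>M) \<le> ennreal (B\<^sup>2 * (LINT x|M. (f x)\<^sup>2))"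
proof -
  have [measurable]: "f \<in> borel_measurable M" using f by measurable
  have "(\<integral>\<^sup>+x. ennreal ((kernel_op f x)\<^sup>2) \<partial>M)
      \<le> (\<integral>\<^sup>+x. ennreal B * (\<integral>\<^sup>+y. ennreal \<bar>k x y\<bar> * ennreal ((f y)\<^sup>2) \<partial>M) \<partial>M)"
    by (intro nn_integral_mono kernel_op_square_le) auto
  also have "\<dots> = ennreal B * (\<integral>\<^sup>+x. (\<integral>\<^sup>+y. ennreal \<bar>k x y\<bar> * ennreal ((f y)\<^sup>2) \<partial>M) \<partial>M)"
    by (rule nn_integral_cmult) measurable
  also have "\<dots> \<le> ennreal B * (ennreal B * (\<integral>\<^sup>+x. ennreal ((f x)\<^sup>2) \<partial>M))"
    by (intro mult_left_mono nn_integral_kernel_mult_snd) auto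
  also have "\<dots> = ennreal (B\<^sup>2 * (LINT x|M. (f x)\<^sup>2))"
    using L2_fun_square[OF f] bound_nonneg
    by (simp add: nn_integral_eq_integral power2_eq_square[of B] mult.assoc flip: ennreal_mult')
  finally show ?thesis .
qed

lemma kernel_op_L2:
  assumes f: "f \<in> L2_fun M"
  shows "kernel_op f \<in> L2_fun M"
proof (rule L2_funI)
  show "kernel_op f \<in> borel_measurable M" using f by measurable
  then show "integrable M (\<lambda>x. (kernel_op f x)\<^sup>2)"
    using order.strict_trans1[OF nn_integral_kernel_op_square_le[OF f] ennreal_less_top]
    by (intro integrableI_bounded) auto
qed

lemma kernel_op_norm_le:
  assumes f: "f \<in> L2_fun M"
  shows "L2_fun_norm M (kernel_op f) \<le> B * L2_fun_norm M f"
proof -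
  have "ennreal (LINT x|M. (kernel_op f x)\<^sup>2) \<le> ennreal (B\<^sup>2 * (LINT x|M. (f x)\<^sup>2))"
    using nn_integral_kernel_op_square_le[OF f] L2_fun_square[OF kernel_op_L2[OF f]]
    by (simp add: nn_integral_eq_integral)
  then have "(LINT x|M. (kernel_op f x)\<^sup>2) \<le> B\<^sup>2 * (LINT x|M. (f x)\<^sup>2)"
    by (simp add: ennreal_le_iff)
  then have "sqrt (LINT x|M. (kernel_op f x)\<^sup>2) \<le> sqrt (B\<^sup>2 * (LINT x|M. (f x)\<^sup>2))"
    by (rule real_sqrt_le_mono)
  then show ?thesis
    using bound_nonneg by (simp add: L2_fun_norm_def L2_inner_def real_sqrt_mult flip: power2_eq_square)
qed

lemma bounded_kernel_op: "bounded_L2_operator M kernel_op"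
  unfolding bounded_L2_operator_def
proof (intro conjI ballI allI impI exI)
  fix f g assume f: "f \<in> L2_fun M" and g: "g \<in> L2_fun M"
  have [measurable]: "f \<in> borel_measurable M" "g \<in> borel_measurable M"
    using f g by measurable
  show "AE x in M. kernel_op f x = kernel_op g x" if fg: "AE x in M. f x = g x"
  proof (rule AE_I2)
    fix x assume [measurable]: "x \<in> space M"
    show "kernel_op f x = kernel_op g x"
      unfolding kernel_op_def by (rule integral_cong_AE) (use fg in auto)
  qed
  show "AE x in M. kernel_op (\<lambda>y. a * f y + b * g y) x = a * kernel_op f x + b * kernel_op g x"
    for a b
    using AE_integrable_kernel[OF f] AE_integrable_kernel[OF g]
  proof eventually_elim
    case (elim x)
    have "kernel_op (\<lambda>y. a * f y + b * g y) x = (LINT y|M. a * (k x y * f y) + b * (k x y * g y))"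
      unfolding kernel_op_def by (rule Bochner_Integration.integral_cong) (auto simp: algebra_simps)
    also have "\<dots> = a * kernel_op f x + b * kernel_op g x"
      using elim unfolding kernel_op_def by simp
    finally show ?case .
  qed
qed (fact kernel_op_L2 kernel_op_norm_le)+

lemma integral_kernel_pairing:
  assumes "f \<in> L2_fun M" "v \<in> L2_fun M"
  shows "integral\<^sup>L (M \<Otimes>\<^sub>M M) (\<lambda>(x, y). k x y * f y * v x) = L2_inner M (kernel_op f) v"
  unfolding L2_inner_def kernel_op_def
  by (subst pair.integral_fst[OF integrable_kernel_pairing[OF assms], symmetric]) simp

end

section \<open>Upper regularity at all radii\<close>

text \<open>Lower regularity forces \<open>r\<^sup>\<delta> \<le> C \<mu>(X)\<close> for every \<open>r\<close> below the diameter.\<close>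

lemma ahlfors_regular_bounded:
  fixes \<mu> :: "'a::{metric_space, second_countable_topology} measure"
  assumes "\<delta> > 0" and \<mu>: "finite_measure \<mu>" and "ahlfors_regular \<delta> \<mu>"
  shows "bounded (UNIV :: 'a set)"
proof -
  interpret finite_measure \<mu> by fact
  obtain C where "C \<ge> 1" and C: "\<And>x r y z. 0 \<le> r \<Longrightarrow> r < dist y (z::'a) \<Longrightarrow>
      r powr \<delta> / C \<le> measure \<mu> (cball x r)"
    using assms(3) unfolding ahlfors_regular_def by blast
  define m where "m = C * measure \<mu> (space \<mu>) + 1"
  have m: "m > 0" using \<open>C \<ge> 1\<close> by (simp add: m_def add_nonneg_pos)
  have "dist y z \<le> m powr (1 / \<delta>)" for y z :: 'a
  proof (rule ccontr)
    assume "\<not> ?thesis"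
    then have "(m powr (1 / \<delta>)) powr \<delta> / C \<le> measure \<mu> (cball y (m powr (1 / \<delta>)))"
      by (intro C[of _ y z]) auto
    also have "\<dots> \<le> measure \<mu> (space \<mu>)" by (rule bounded_measure)
    finally show False
      using \<open>C \<ge> 1\<close> \<open>\<delta> > 0\<close> m by (simp add: powr_powr divide_simps m_def mult.commute)
  qed
  then show ?thesis unfolding bounded_two_points by blast
qed

text \<open>Ahlfors regularity speaks of radii below the diameter only.  At larger radii finiteness of
  \<open>\<mu>\<close> suffices, at the price of a larger constant.\<close>

lemma ahlfors_regular_upper:
  fixes \<mu> :: "'a::{metric_space, second_countable_topology} measure"
  assumes "\<delta> > 0" and \<mu>: "finite_measure \<mu>" and "ahlfors_regular \<delta> \<mu>"
    and D: "0 < diameter (UNIV :: 'a set)"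
  obtains C where "C \<ge> 0" "\<And>x r. 0 < r \<Longrightarrow> measure \<mu> (cball x r) \<le> C * r powr \<delta>"
proof -
  interpret finite_measure \<mu> by fact
  obtain C where "C \<ge> 1" and C: "\<And>x r y z. 0 \<le> r \<Longrightarrow> r < dist y (z::'a) \<Longrightarrow>
      measure \<mu> (cball x r) \<le> C * r powr \<delta>"
    using assms(3) unfolding ahlfors_regular_def by blast
  let ?D = "diameter (UNIV :: 'a set)" and ?m = "measure \<mu> (space \<mu>)"
  have "measure \<mu> (cball x r) \<le> max C (?m / ?D powr \<delta>) * r powr \<delta>" if "0 < r" for x r
  proof (cases "\<exists>y z::'a. r < dist y z")
    case True
    then have "measure \<mu> (cball x r) \<le> C * r powr \<delta>" using C that by (meson less_imp_le)
    also have "\<dots> \<le> max C (?m / ?D powr \<delta>) * r powr \<delta>" by (intro mult_right_mono) auto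
    finally show ?thesis .
  next
    case False
    then have "?D \<le> r" unfolding diameter_def
      by (auto simp: not_less intro!: cSUP_least)
    have "measure \<mu> (cball x r) \<le> ?m" by (rule bounded_measure)
    also have "\<dots> = ?m / ?D powr \<delta> * ?D powr \<delta>" using D by simp
    also have "\<dots> \<le> ?m / ?D powr \<delta> * r powr \<delta>"
      using \<open>?D \<le> r\<close> D \<open>\<delta> > 0\<close> by (intro mult_left_mono powr_mono2) auto
    also have "\<dots> \<le> max C (?m / ?D powr \<delta>) * r powr \<delta>" by (intro mult_right_mono) auto
    finally show ?thesis .
  qed
  moreover have "0 \<le> max C (?m / ?D powr \<delta>)" using \<open>C \<ge> 1\<close> by simp
  ultimately show ?thesis using that by blast
qed

section \<open>The modulus of continuity\<close>

lemma modulus_cont_upper: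
  fixes h :: "'a::metric_space \<Rightarrow> real"
  assumes "bounded (range h)" "dist x y \<le> t * diameter (UNIV :: 'a set)"
  shows "\<bar>h x - h y\<bar> \<le> modulus_cont h t"
proof -
  obtain H where H: "\<And>x. \<bar>h x\<bar> \<le> H" using assms(1) by (auto simp: bounded_iff)
  have "\<bar>h u - h v\<bar> \<le> 2 * H" for u v using H[of u] H[of v] by linarith
  then have "bdd_above {\<bar>h x - h y\<bar> | x y. dist x y \<le> t * diameter (UNIV :: 'a set)}"
    by (intro bdd_aboveI[of _ "2 * H"]) blast
  then show ?thesis unfolding modulus_cont_def using assms(2) by (intro cSup_upper) auto
qed

lemma modulus_cont_le:
  fixes h :: "'a::metric_space \<Rightarrow> real"
  assumes "bounded (UNIV :: 'a set)" "0 \<le> t"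
    "\<And>x y. dist x y \<le> t * diameter (UNIV :: 'a set) \<Longrightarrow> \<bar>h x - h y\<bar> \<le> c"
  shows "modulus_cont h t \<le> c"
proof -
  have "0 \<le> t * diameter (UNIV :: 'a set)"
    using assms(1,2) by (simp add: diameter_ge_0)
  then have "\<exists>x y :: 'a. dist x y \<le> t * diameter (UNIV :: 'a set)"
    by (metis dist_self)
  then show ?thesis unfolding modulus_cont_def using assms(3) by (intro cSup_least) auto
qed

lemma modulus_cont_mono:
  fixes h :: "'a::metric_space \<Rightarrow> real"
  assumes "bounded (UNIV :: 'a set)" "bounded (range h)" "0 \<le> s" "s \<le> t"
  shows "modulus_cont h s \<le> modulus_cont h t"
proof (rule modulus_cont_le[OF assms(1,3)])
  fix x y :: 'a
  assume "dist x y \<le> s * diameter (UNIV :: 'a set)"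
  also have "\<dots> \<le> t * diameter (UNIV :: 'a set)"
    using assms by (intro mult_right_mono) (auto simp: diameter_ge_0)
  finally show "\<bar>h x - h y\<bar> \<le> modulus_cont h t" by (rule modulus_cont_upper[OF assms(2)])
qed

lemma modulus_cont_nonneg:
  fixes h :: "'a::metric_space \<Rightarrow> real"
  assumes "bounded (UNIV :: 'a set)" "bounded (range h)" "0 \<le> t"
  shows "0 \<le> modulus_cont h t"
  using modulus_cont_upper[OF assms(2), of undefined undefined t] assms(1,3)
  by (simp add: diameter_ge_0)

lemma Lipschitz_dini_continuous:
  fixes v :: "'a::metric_space \<Rightarrow> real"
  assumes bdd: "bounded (UNIV :: 'a set)" and v: "L-lipschitz_on UNIV v"
    and range: "bounded (range v)"
  shows "dini_continuous v"
proof -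
  let ?D = "diameter (UNIV :: 'a set)"
  have L: "0 \<le> L" using v by (rule lipschitz_on_nonneg)
  have "modulus_cont v t / t \<le> L * ?D" if "0 < t" for t
  proof -
    have "modulus_cont v t \<le> L * (t * ?D)"
    proof (rule modulus_cont_le[OF bdd])
      fix x y :: 'a
      assume xy: "dist x y \<le> t * ?D"
      have "\<bar>v x - v y\<bar> \<le> L * dist x y" using lipschitz_onD[OF v, of x y] by (simp add: dist_real_def)
      also have "\<dots> \<le> L * (t * ?D)" using xy L by (rule mult_left_mono)
      finally show "\<bar>v x - v y\<bar> \<le> L * (t * ?D)" .
    qed (use that in simp)
    then show ?thesis using that by (simp add: field_simps)
  qed
  note pt = this
  have "(\<integral>\<^sup>+ t\<in>{0<..1}. ennreal (modulus_cont v t / t) \<partial>lborel)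
      \<le> (\<integral>\<^sup>+ t. ennreal (L * ?D) * indicator {0<..1::real} t \<partial>lborel)"
    by (intro nn_integral_mono) (simp add: indicator_def ennreal_leI pt)
  also have "\<dots> < \<infinity>" by (simp add: nn_integral_cmult_indicator)
  finally show ?thesis
    using range lipschitz_on_uniformly_continuous[OF v] by (simp add: dini_continuous_def)
qed

section \<open>The kernel of a Dini continuous function\<close>

text \<open>If \<open>X\<close> is a single point, regularity says nothing and \<open>\<mu>\<close> may have an atom; the ball bound
  is therefore conditional on a positive diameter.\<close>

locale upper_regular_space = finite_measure M
  for M :: "'a::{metric_space, second_countable_topology} measure" +
  fixes \<delta> C :: real
  assumes borel_sets: "sets M = sets borel"
    and exponent_pos: "0 < \<delta>"
    and bounded_space: "bounded (UNIV :: 'a set)"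
    and const_nonneg: "0 \<le> C"
    and ball_upper: "0 < diameter (UNIV :: 'a set) \<Longrightarrow> 0 < r \<Longrightarrow> measure M (cball x r) \<le> C * r powr \<delta>"
begin

lemma space_eq_UNIV [simp]: "space M = UNIV"
  using sets_eq_imp_space_eq[OF borel_sets] by simp

lemma ident_measurable [measurable]: "(\<lambda>x. x) \<in> measurable M borel"
  by (rule measurable_ident_sets[OF borel_sets])

lemma dist_measurable [measurable]: "(\<lambda>(x, y). dist x y) \<in> borel_measurable (M \<Otimes>\<^sub>M M)"
  unfolding case_prod_beta
  by (intro borel_measurable_dist measurable_compose[OF measurable_fst ident_measurable]
      measurable_compose[OF measurable_snd ident_measurable])

lemma dini_measurable:
  assumes "dini_continuous h"
  shows "h \<in> borel_measurable M"
proof -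
  have "h \<in> borel_measurable borel"
    using assms unfolding dini_continuous_def
    by (intro borel_measurable_continuous_onI uniformly_continuous_imp_continuous) blast
  then show ?thesis using measurable_cong_sets[OF borel_sets refl] by blast
qed

definition dini_kernel :: "('a \<Rightarrow> real) \<Rightarrow> 'a \<Rightarrow> 'a \<Rightarrow> real" where
  "dini_kernel h x y = (h x - h y) / dist x y powr \<delta>"

lemma dini_kernel_measurable:
  assumes [measurable]: "h \<in> borel_measurable M"
  shows "(\<lambda>(x, y). dini_kernel h x y) \<in> borel_measurable (M \<Otimes>\<^sub>M M)"
  unfolding dini_kernel_def by measurable

text \<open>Let \<open>\<omega>\<close> be the modulus of continuity of \<open>h\<close> and \<open>D > 0\<close> the diameter.  The idea is to
  write the singular kernel as a superposition of indicators of balls: up to a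
  bounded term, \<open>\<bar>h x - h y\<bar> / d(x, y)\<^sup>\<delta>\<close> is at most a constant times the integral of
  \<open>\<omega>(t) t\<^bsup>-\<delta>-1\<^esup>\<close> over the \<open>t \<le> 1\<close> with \<open>d(x, y) \<le> t D\<close>, because \<open>\<omega>\<close> is monotone and this
  range contains \<open>[s, 2 s]\<close> for \<open>s = d(x, y) / D \<le> 1 / 2\<close>.  After exchanging the integrals, the
  ball of radius \<open>t D\<close> contributes at most \<open>C (t D)\<^sup>\<delta>\<close>, which leaves the Dini integral.\<close>

lemma dini_kernel_row_bound:
  assumes dini: "dini_continuous h"
  obtains B where "0 \<le> B" "\<And>x. (\<integral>\<^sup>+y. ennreal \<bar>dini_kernel h x y\<bar> \<partial>M) \<le> ennreal B"
proof (cases "diameter (UNIV :: 'a set) = 0")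
  case True
  have "dist x y \<le> 0" for x y :: 'a
    using diameter_bounded_bound[OF bounded_space, of x y] True by simp
  then have "x = y" for x y :: 'a by simp
  then have "dini_kernel h x y = 0" for x y
    unfolding dini_kernel_def by (metis diff_self div_0)
  then show ?thesis by (intro that[of 0]) simp_all
next
  case False
  define D where "D = diameter (UNIV :: 'a set)"
  have D: "0 < D" using False diameter_ge_0[OF bounded_space] by (simp add: D_def)
  have hb: "bounded (range h)"
    and J: "(\<integral>\<^sup>+ t\<in>{0<..1}. ennreal (modulus_cont h t / t) \<partial>lborel) < \<infinity>" (is "?J < _")
    using dini by (auto simp: dini_continuous_def)
  have [measurable]: "h \<in> borel_measurable M" by (rule dini_measurable[OF dini])
  obtain H where H: "\<And>x. \<bar>h x\<bar> \<le> H" using hb by (auto simp: bounded_iff)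
  have H0: "0 \<le> H" using H[of undefined] by linarith
  \<comment> \<open>Cutting off at \<open>0\<close> makes the modulus monotone on the whole line, hence Borel.\<close>
  define W where "W t = modulus_cont h (max t 0)" for t
  have W_nonneg: "0 \<le> W t" for t
    unfolding W_def by (intro modulus_cont_nonneg bounded_space hb) simp
  have "mono W"
    unfolding W_def by (intro monoI modulus_cont_mono bounded_space hb) auto
  then have [measurable]: "W \<in> borel_measurable borel" by (rule borel_measurable_mono)
  define \<Phi> where "\<Phi> x y t = (if 0 < t \<and> t \<le> 1 \<and> dist x y \<le> t * D
      then ennreal (W t * t powr (- \<delta> - 1)) else 0)" for x y :: 'a and t :: real
  have [measurable]: "(\<lambda>y. dist x y) \<in> borel_measurable M" for x
    by (intro borel_measurable_dist measurable_const ident_measurable) simp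
  have \<Phi>_meas [measurable]: "(\<lambda>(y, t). \<Phi> x y t) \<in> borel_measurable (M \<Otimes>\<^sub>M lborel)" for x
    unfolding \<Phi>_def by measurable
  \<comment> \<open>\<open>c1\<close> bounds the kernel where \<open>d(x, y) > D / 2\<close>; \<open>c2\<close> compensates
    \<open>\<integral> t\<^bsup>-\<delta>-1\<^esup> dt \<ge> s (2 s)\<^bsup>-\<delta>-1\<^esup>\<close> over \<open>[s, 2 s]\<close>.\<close>
  define c1 where "c1 = 2 * H / (D / 2) powr \<delta>"
  define c2 where "c2 = 2 powr (\<delta> + 1) * D powr (- \<delta>)"
  have c0: "0 \<le> c1" "0 \<le> c2" using H0 by (auto simp: c1_def c2_def)
  have pt: "ennreal \<bar>dini_kernel h x y\<bar> \<le> ennreal c1 + ennreal c2 * (\<integral>\<^sup>+t. \<Phi> x y t \<partial>lborel)" for x y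
  proof (cases "x = y")
    case True then show ?thesis by (simp add: dini_kernel_def)
  next
    case False
    define s where "s = dist x y / D"
    have s: "0 < s" "dist x y = s * D" using False D by (auto simp: s_def)
    show ?thesis
    proof (cases "s \<le> 1 / 2")
      case True
      have "\<bar>dini_kernel h x y\<bar> = \<bar>h x - h y\<bar> * (s * D) powr (- \<delta>)"
        by (simp add: dini_kernel_def s(2) powr_minus divide_inverse abs_mult)
      also have "\<dots> \<le> W s * (s * D) powr (- \<delta>)"
      proof (rule mult_right_mono)
        show "\<bar>h x - h y\<bar> \<le> W s"
          unfolding W_def using s by (intro modulus_cont_upper hb) (simp add: D_def)
      qed simp
      also have "(s * D) powr (- \<delta>) = c2 * ((2 * s) powr (- \<delta> - 1) * s)"
      proof -
        have "(2 * s) powr (- \<delta> - 1) = 2 powr (- \<delta> - 1) * s powr (- \<delta> - 1)"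
          using s by (simp add: powr_mult)
        moreover have "2 powr (\<delta> + 1) * 2 powr (- \<delta> - 1) = (1::real)"
          by (simp flip: powr_add)
        moreover have "s powr (- \<delta> - 1) * s = s powr (- \<delta>)"
          using s by (simp add: powr_diff)
        moreover have "(s * D) powr (- \<delta>) = s powr (- \<delta>) * D powr (- \<delta>)"
          using s D by (simp add: powr_mult)
        ultimately show ?thesis unfolding c2_def by (simp add: algebra_simps)
      qed
      finally have "\<bar>dini_kernel h x y\<bar> \<le> c2 * (W s * (2 * s) powr (- \<delta> - 1) * s)"
        by (simp add: mult_ac)
      then have "ennreal \<bar>dini_kernel h x y\<bar> \<le> ennreal c2 * ennreal (W s * (2 * s) powr (- \<delta> - 1) * s)"
        using c0 by (simp add: ennreal_leI flip: ennreal_mult')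
      also have "ennreal (W s * (2 * s) powr (- \<delta> - 1) * s)
          = (\<integral>\<^sup>+t. ennreal (W s * (2 * s) powr (- \<delta> - 1)) * indicator {s..2 * s} t \<partial>lborel)"
        using s W_nonneg by (simp add: nn_integral_cmult_indicator flip: ennreal_mult')
      also have "\<dots> \<le> (\<integral>\<^sup>+t. \<Phi> x y t \<partial>lborel)"
      proof (rule nn_integral_mono)
        fix t
        show "ennreal (W s * (2 * s) powr (- \<delta> - 1)) * indicator {s..2 * s} t \<le> \<Phi> x y t"
        proof (cases "t \<in> {s..2 * s}")
          case t: True
          have "W s * (2 * s) powr (- \<delta> - 1) \<le> W t * t powr (- \<delta> - 1)"
            using t s exponent_pos W_nonneg \<open>mono W\<close>
            by (intro mult_mono powr_mono2') (auto dest: monoD)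
          then show ?thesis
            using t s True D by (auto simp: \<Phi>_def intro!: ennreal_leI)
        qed simp
      qed
      finally have "ennreal \<bar>dini_kernel h x y\<bar> \<le> ennreal c2 * (\<integral>\<^sup>+t. \<Phi> x y t \<partial>lborel)"
        by (simp add: mult_left_mono)
      then show ?thesis by (rule add_increasing[OF zero_le])
    next
      case False
      have "D / 2 \<le> dist x y" using False D s(2) by simp
      have "\<bar>dini_kernel h x y\<bar> \<le> c1"
        unfolding dini_kernel_def c1_def abs_divide
      proof (rule frac_le)
        show "\<bar>h x - h y\<bar> \<le> 2 * H" using H[of x] H[of y] by linarith
        show "(D / 2) powr \<delta> \<le> \<bar>dist x y powr \<delta>\<bar>"
          using \<open>D / 2 \<le> dist x y\<close> D exponent_pos by (simp add: powr_mono2)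
      qed (use H0 D in auto)
      then show ?thesis by (intro add_increasing2[OF zero_le] ennreal_leI)
    qed
  qed
  have ball: "(\<integral>\<^sup>+y. \<Phi> x y t \<partial>M)
      \<le> ennreal (C * D powr \<delta>) * (ennreal (modulus_cont h t / t) * indicator {0<..1} t)" for x t
  proof (cases "0 < t \<and> t \<le> 1")
    case True
    have "(\<integral>\<^sup>+y. \<Phi> x y t \<partial>M)
        = (\<integral>\<^sup>+y. ennreal (W t * t powr (- \<delta> - 1)) * indicator (cball x (t * D)) y \<partial>M)"
      using True by (intro nn_integral_cong) (auto simp: \<Phi>_def indicator_def)
    also have "\<dots> = ennreal (W t * t powr (- \<delta> - 1)) * emeasure M (cball x (t * D))"
      by (rule nn_integral_cmult_indicator) (simp add: borel_sets)
    also have "\<dots> \<le> ennreal (W t * t powr (- \<delta> - 1)) * ennreal (C * (t * D) powr \<delta>)"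
      using True D ball_upper[of "t * D" x]
      by (intro mult_left_mono) (auto simp: emeasure_eq_measure D_def intro!: ennreal_leI)
    also have "\<dots> = ennreal (C * D powr \<delta> * (W t / t))"
    proof -
      have "W t * t powr (- \<delta> - 1) * (C * (t * D) powr \<delta>)
          = C * D powr \<delta> * (W t * (t powr (- \<delta> - 1) * t powr \<delta>))"
        using True D by (simp add: powr_mult mult_ac)
      also have "t powr (- \<delta> - 1) * t powr \<delta> = 1 / t"
        using True by (simp add: powr_minus_divide flip: powr_add)
      finally have "W t * t powr (- \<delta> - 1) * (C * (t * D) powr \<delta>) = C * D powr \<delta> * (W t / t)"
        by simp
      then show ?thesis using W_nonneg by (simp flip: ennreal_mult')
    qed
    finally show ?thesis
      using True const_nonneg W_nonneg by (simp add: W_def flip: ennreal_mult')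
  qed (auto simp: \<Phi>_def)
  interpret space_scale: pair_sigma_finite M lborel ..
  define B where "B = ennreal c1 * emeasure M (space M)
      + ennreal c2 * (ennreal (C * D powr \<delta>) * ?J)"
  have "B < \<infinity>"
    using J unfolding B_def by (simp add: ennreal_mult_less_top emeasure_eq_measure)
  moreover have "(\<integral>\<^sup>+y. ennreal \<bar>dini_kernel h x y\<bar> \<partial>M) \<le> B" for x
  proof -
    have "(\<integral>\<^sup>+y. ennreal \<bar>dini_kernel h x y\<bar> \<partial>M)
        \<le> (\<integral>\<^sup>+y. ennreal c1 + ennreal c2 * (\<integral>\<^sup>+t. \<Phi> x y t \<partial>lborel) \<partial>M)"
      by (rule nn_integral_mono) (rule pt)
    also have "\<dots> = ennreal c1 * emeasure M (space M)
        + ennreal c2 * (\<integral>\<^sup>+y. (\<integral>\<^sup>+t. \<Phi> x y t \<partial>lborel) \<partial>M)"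
      by (simp add: nn_integral_add nn_integral_cmult)
    also have "(\<integral>\<^sup>+y. (\<integral>\<^sup>+t. \<Phi> x y t \<partial>lborel) \<partial>M) = (\<integral>\<^sup>+t. (\<integral>\<^sup>+y. \<Phi> x y t \<partial>M) \<partial>lborel)"
      by (rule space_scale.Fubini'[symmetric]) measurable
    also have "\<dots> \<le> (\<integral>\<^sup>+t. ennreal (C * D powr \<delta>) * (ennreal (modulus_cont h t / t) * indicator {0<..1} t) \<partial>lborel)"
      by (rule nn_integral_mono) (rule ball)
    also have "\<dots> = (\<integral>\<^sup>+t. ennreal (C * D powr \<delta>) * (ennreal (W t / t) * indicator {0<..1} t) \<partial>lborel)"
      by (intro nn_integral_cong) (auto simp: W_def indicator_def)
    also have "\<dots> = ennreal (C * D powr \<delta>) * (\<integral>\<^sup>+t. ennreal (W t / t) * indicator {0<..1} t \<partial>lborel)"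
      by (rule nn_integral_cmult) measurable
    also have "(\<integral>\<^sup>+t. ennreal (W t / t) * indicator {0<..1} t \<partial>lborel) = ?J"
      by (intro nn_integral_cong) (auto simp: W_def indicator_def)
    finally show ?thesis unfolding B_def by (simp add: mult_left_mono)
  qed
  ultimately show ?thesis
    by (intro that[of "enn2real B"]) (auto simp: ennreal_enn2real_if)
qed

lemma schur_kernel_dini:
  assumes "dini_continuous h"
  obtains B where "schur_kernel M (dini_kernel h) B"
proof -
  obtain B where B: "0 \<le> B" "\<And>x. (\<integral>\<^sup>+y. ennreal \<bar>dini_kernel h x y\<bar> \<partial>M) \<le> ennreal B"
    using dini_kernel_row_bound[OF assms] by blast
  have "schur_kernel M (dini_kernel h) B"
  proof
    show "\<bar>dini_kernel h x y\<bar> = \<bar>dini_kernel h y x\<bar>" for x y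
      by (simp add: dini_kernel_def abs_minus_commute dist_commute)
  qed (use B dini_kernel_measurable[OF dini_measurable[OF assms]] in auto)
  then show ?thesis by (rule that)
qed

section \<open>The energy form as an integral over the product space\<close>

sublocale pair: pair_sigma_finite M M ..

definition energy_density :: "('a \<Rightarrow> real) \<Rightarrow> ('a \<Rightarrow> real) \<Rightarrow> 'a \<times> 'a \<Rightarrow> real" where
  "energy_density u v = (\<lambda>(x, y). (u x - u y) * (v x - v y) / dist x y powr \<delta>)"

lemma energy_density_measurable [measurable]:
  assumes [measurable]: "u \<in> borel_measurable M" "v \<in> borel_measurable M"
  shows "energy_density u v \<in> borel_measurable (M \<Otimes>\<^sub>M M)"
  unfolding energy_density_def by measurable

lemma dom_energy_L2: "u \<in> dom_energy \<delta> M \<Longrightarrow> u \<in> L2_fun M"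
  by (simp add: dom_energy_def)

lemma dom_energy_iff:
  assumes "u \<in> L2_fun M"
  shows "u \<in> dom_energy \<delta> M \<longleftrightarrow> integrable (M \<Otimes>\<^sub>M M) (energy_density u u)"
proof -
  have [measurable]: "u \<in> borel_measurable M" using assms by measurable
  \<comment> \<open>On the diagonal both integrands vanish, since the numerator does.\<close>
  have "(\<integral>\<^sup>+ x. (\<integral>\<^sup>+ y\<in>-{x}. ennreal (\<bar>u x - u y\<bar>\<^sup>2 / dist x y powr \<delta>) \<partial>M) \<partial>M)
      = (\<integral>\<^sup>+ x. (\<integral>\<^sup>+ y. ennreal (norm (energy_density u u (x, y))) \<partial>M) \<partial>M)"
    by (intro nn_integral_cong) (auto simp: energy_density_def power2_eq_square indicator_def)
  also have "\<dots> = (\<integral>\<^sup>+ p. ennreal (norm (energy_density u u p)) \<partial>(M \<Otimes>\<^sub>M M))"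
    by (rule nn_integral_fst) measurable
  finally show ?thesis
    using assms by (simp add: dom_energy_def integrable_iff_bounded)
qed

lemma integrable_energy_density:
  assumes u: "u \<in> dom_energy \<delta> M" and v: "v \<in> dom_energy \<delta> M"
  shows "integrable (M \<Otimes>\<^sub>M M) (energy_density u v)"
proof (rule Bochner_Integration.integrable_bound)
  show "integrable (M \<Otimes>\<^sub>M M) (\<lambda>p. energy_density u u p + energy_density v v p)"
    using u v dom_energy_iff dom_energy_L2 by (intro Bochner_Integration.integrable_add) auto
  have [measurable]: "u \<in> borel_measurable M" "v \<in> borel_measurable M"
    using dom_energy_L2[OF u] dom_energy_L2[OF v] by measurable
  show "energy_density u v \<in> borel_measurable (M \<Otimes>\<^sub>M M)" by measurable
  have "\<bar>a * b / c\<bar> \<le> \<bar>a * a / c + b * b / c\<bar>" if "0 \<le> c" for a b c :: real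
  proof -
    have "\<bar>a * b\<bar> \<le> a * a + b * b"
      using abs_mult_le_squares[of a b] by (simp add: power2_eq_square)
    then have "\<bar>a * b\<bar> / c \<le> (a * a + b * b) / c" using that by (rule divide_right_mono)
    then show ?thesis using that by (simp add: abs_divide add_divide_distrib)
  qed
  then show "AE p in M \<Otimes>\<^sub>M M. norm (energy_density u v p)
      \<le> norm (energy_density u u p + energy_density v v p)"
    by (auto simp: energy_density_def)
qed

lemma energy_eq:
  assumes "u \<in> dom_energy \<delta> M" "v \<in> dom_energy \<delta> M"
  shows "energy \<delta> M u v = 1 / 2 * integral\<^sup>L (M \<Otimes>\<^sub>M M) (energy_density u v)"
proof -
  have "(LINT y:-{x}|M. (u x - u y) * (v x - v y) / dist x y powr \<delta>)
      = (LINT y|M. energy_density u v (x, y))" for x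
    unfolding set_lebesgue_integral_def
    by (intro Bochner_Integration.integral_cong) (auto simp: energy_density_def indicator_def)
  then show ?thesis
    unfolding energy_def using pair.integral_fst'[OF integrable_energy_density[OF assms]] by simp
qed

section \<open>Multiplication by a Dini continuous function\<close>

lemma K_op_integrand:
  "indicator (- {x}) y *\<^sub>R ((h x - h y) / dist x y powr \<delta> * f y) = dini_kernel h x y * f y"
  by (cases "x = y") (simp_all add: dini_kernel_def)

lemma K_op_eq_kernel_op:
  assumes "schur_kernel M (dini_kernel h) B"
  shows "K_op \<delta> M h = schur_kernel.kernel_op M (dini_kernel h)"
  unfolding K_op_def[abs_def] schur_kernel.kernel_op_def[OF assms, abs_def]
    set_lebesgue_integral_def K_op_integrand ..

text \<open>Split \<open>h(x) v(x) - h(y) v(y) = h(x) (v(x) - v(y)) + (h(x) - h(y)) v(y)\<close>.  The first summand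
  leads to the energy of \<open>v\<close>, the second to \<open>v(y)\<^sup>2 (h(x) - h(y))\<^sup>2 / d(x, y)\<^sup>\<delta>\<close>.  The latter is at most \<open>2 \<parallel>h\<parallel> v(y)\<^sup>2 \<bar>k(x, y)\<bar>\<close> for the Dini kernel \<open>k\<close>, so the Schur bound applies.\<close>

lemma dom_energy_dini_mult:
  assumes h: "dini_continuous h" and v: "v \<in> dom_energy \<delta> M"
  shows "(\<lambda>x. h x * v x) \<in> dom_energy \<delta> M"
proof -
  obtain B where B: "schur_kernel M (dini_kernel h) B" by (rule schur_kernel_dini[OF h])
  interpret schur_kernel M "dini_kernel h" B by fact
  obtain H where H: "\<And>x. \<bar>h x\<bar> \<le> H" using h by (auto simp: dini_continuous_def bounded_iff)
  have [measurable]: "h \<in> borel_measurable M" by (rule dini_measurable[OF h])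
  have vL: "v \<in> L2_fun M" by (rule dom_energy_L2[OF v])
  then have [measurable]: "v \<in> borel_measurable M" by measurable
  have hv: "(\<lambda>x. h x * v x) \<in> L2_fun M" by (rule L2_fun_bounded_mult[OF _ H vL]) measurable
  have pt: "ennreal (norm (energy_density (\<lambda>x. h x * v x) (\<lambda>x. h x * v x) (x, y)))
      \<le> ennreal (2 * H\<^sup>2) * ennreal (norm (energy_density v v (x, y)))
        + ennreal (4 * H) * (ennreal \<bar>dini_kernel h x y\<bar> * ennreal ((v y)\<^sup>2))" for x y
  proof -
    have H0: "0 \<le> H" using H[of x] by linarith
    have "(h x * v x - h y * v y)\<^sup>2 = (h x * (v x - v y) + (h x - h y) * v y)\<^sup>2"
      by (simp add: algebra_simps)
    also have "\<dots> \<le> 2 * (h x * (v x - v y))\<^sup>2 + 2 * ((h x - h y) * v y)\<^sup>2"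
      using sum_squares_bound[of "h x * (v x - v y)" "(h x - h y) * v y"] by (simp add: power2_sum)
    also have "(h x * (v x - v y))\<^sup>2 \<le> H\<^sup>2 * (v x - v y)\<^sup>2"
      using H[of x] H0 unfolding power_mult_distrib
      by (intro mult_right_mono) (auto simp: abs_le_square_iff[symmetric])
    also have "((h x - h y) * v y)\<^sup>2 \<le> 2 * H * \<bar>h x - h y\<bar> * (v y)\<^sup>2"
    proof -
      have "\<bar>h x - h y\<bar> * \<bar>h x - h y\<bar> \<le> 2 * H * \<bar>h x - h y\<bar>"
        using H[of x] H[of y] by (intro mult_right_mono) auto
      then show ?thesis
        unfolding power_mult_distrib by (intro mult_right_mono) (auto simp: power2_eq_square)
    qed
    finally have "(h x * v x - h y * v y)\<^sup>2 / dist x y powr \<delta>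
        \<le> (2 * (H\<^sup>2 * (v x - v y)\<^sup>2) + 2 * (2 * H * \<bar>h x - h y\<bar> * (v y)\<^sup>2)) / dist x y powr \<delta>"
      by (intro divide_right_mono) auto
    also have "\<dots> = 2 * H\<^sup>2 * ((v x - v y)\<^sup>2 / dist x y powr \<delta>)
        + 4 * H * (\<bar>h x - h y\<bar> / dist x y powr \<delta> * (v y)\<^sup>2)"
      by (simp add: add_divide_distrib)
    finally have "(h x * v x - h y * v y)\<^sup>2 / dist x y powr \<delta> \<le> \<dots>" .
    then show ?thesis
      using H0 by (simp add: energy_density_def dini_kernel_def power2_eq_square abs_divide
          ennreal_leI flip: ennreal_mult' ennreal_plus)
  qed
  have "(\<integral>\<^sup>+p. ennreal (norm (energy_density (\<lambda>x. h x * v x) (\<lambda>x. h x * v x) p)) \<partial>(M \<Otimes>\<^sub>M M))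
      \<le> (\<integral>\<^sup>+p. ennreal (2 * H\<^sup>2) * ennreal (norm (energy_density v v p))
        + ennreal (4 * H) * (case p of (x, y) \<Rightarrow> ennreal \<bar>dini_kernel h x y\<bar> * ennreal ((v y)\<^sup>2))
        \<partial>(M \<Otimes>\<^sub>M M))"
    by (intro nn_integral_mono) (use pt in auto)
  also have "\<dots> = ennreal (2 * H\<^sup>2) * (\<integral>\<^sup>+p. ennreal (norm (energy_density v v p)) \<partial>(M \<Otimes>\<^sub>M M))
      + ennreal (4 * H) * (\<integral>\<^sup>+p. (case p of (x, y) \<Rightarrow> ennreal \<bar>dini_kernel h x y\<bar> * ennreal ((v y)\<^sup>2))
        \<partial>(M \<Otimes>\<^sub>M M))"
    by (simp add: nn_integral_add nn_integral_cmult)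
  also have "(\<integral>\<^sup>+p. (case p of (x, y) \<Rightarrow> ennreal \<bar>dini_kernel h x y\<bar> * ennreal ((v y)\<^sup>2)) \<partial>(M \<Otimes>\<^sub>M M))
      = (\<integral>\<^sup>+x. (\<integral>\<^sup>+y. ennreal \<bar>dini_kernel h x y\<bar> * ennreal ((v y)\<^sup>2) \<partial>M) \<partial>M)"
    by (subst nn_integral_fst[symmetric]) auto
  also have "\<dots> \<le> ennreal B * (\<integral>\<^sup>+x. ennreal ((v x)\<^sup>2) \<partial>M)"
    by (rule nn_integral_kernel_mult_snd) measurable
  finally have "(\<integral>\<^sup>+p. ennreal (norm (energy_density (\<lambda>x. h x * v x) (\<lambda>x. h x * v x) p)) \<partial>(M \<Otimes>\<^sub>M M))
      \<le> ennreal (2 * H\<^sup>2) * (\<integral>\<^sup>+p. ennreal (norm (energy_density v v p)) \<partial>(M \<Otimes>\<^sub>M M))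
      + ennreal (4 * H) * (ennreal B * (\<integral>\<^sup>+x. ennreal ((v x)\<^sup>2) \<partial>M))"
    by (simp add: mult_left_mono)
  also have "\<dots> < \<infinity>"
    using v L2_fun_square[OF vL] by (simp add: dom_energy_iff[OF vL] integrable_iff_bounded ennreal_mult_less_top)
  finally show ?thesis
    unfolding dom_energy_iff[OF hv] by (intro integrableI_bounded) measurable
qed

text \<open>Pointwise, the energy densities of \<open>(h f, v)\<close> and \<open>(f, h v)\<close> differ by
  \<open>k(x, y) (f(y) v(x) - f(x) v(y))\<close>.  Since \<open>k\<close> is antisymmetric, the two terms have the same
  integral, which compensates the factor \<open>1/2\<close> in the energy.\<close>

lemma energy_dini_mult:
  assumes h: "dini_continuous h" and f: "f \<in> dom_energy \<delta> M" and v: "v \<in> dom_energy \<delta> M"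
  shows "energy \<delta> M (\<lambda>x. h x * f x) v = energy \<delta> M f (\<lambda>x. h x * v x) + L2_inner M (K_op \<delta> M h f) v"
proof -
  obtain B where B: "schur_kernel M (dini_kernel h) B" by (rule schur_kernel_dini[OF h])
  interpret schur_kernel M "dini_kernel h" B by fact
  have fL: "f \<in> L2_fun M" and vL: "v \<in> L2_fun M" using f v by (auto intro: dom_energy_L2)
  note hf = dom_energy_dini_mult[OF h f] and hv = dom_energy_dini_mult[OF h v]
  define P where "P = (\<lambda>(x, y). dini_kernel h x y * f y * v x)"
  have P: "integrable (M \<Otimes>\<^sub>M M) P" unfolding P_def by (rule integrable_kernel_pairing[OF fL vL])
  have swap_int: "integrable (M \<Otimes>\<^sub>M M) (\<lambda>(x, y). P (y, x))"
    by (rule pair.integrable_product_swap[OF P])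
  have swap: "integral\<^sup>L (M \<Otimes>\<^sub>M M) (\<lambda>(x, y). P (y, x)) = integral\<^sup>L (M \<Otimes>\<^sub>M M) P"
    using P by (intro pair.integral_product_swap) auto
  have "energy_density (\<lambda>x. h x * f x) v p
      = energy_density f (\<lambda>x. h x * v x) p + (P p + (case p of (x, y) \<Rightarrow> P (y, x)))" for p
  proof (cases p)
    case (Pair x y)
    have "(h x * f x - h y * f y) * (v x - v y)
        = (f x - f y) * (h x * v x - h y * v y) + ((h x - h y) * f y * v x + (h y - h x) * f x * v y)"
      by (simp add: algebra_simps)
    then show ?thesis
      by (simp add: Pair energy_density_def P_def dini_kernel_def dist_commute[of y x]
          flip: add_divide_distrib)
  qed
  then have "integral\<^sup>L (M \<Otimes>\<^sub>M M) (energy_density (\<lambda>x. h x * f x) v)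
      = integral\<^sup>L (M \<Otimes>\<^sub>M M) (\<lambda>p. energy_density f (\<lambda>x. h x * v x) p
          + (P p + (case p of (x, y) \<Rightarrow> P (y, x))))"
    by presburger
  also have "\<dots> = integral\<^sup>L (M \<Otimes>\<^sub>M M) (energy_density f (\<lambda>x. h x * v x)) + 2 * integral\<^sup>L (M \<Otimes>\<^sub>M M) P"
    using P swap_int integrable_energy_density[OF f hv] swap by simp
  also have "integral\<^sup>L (M \<Otimes>\<^sub>M M) P = L2_inner M (K_op \<delta> M h f) v"
    unfolding P_def K_op_eq_kernel_op[OF B] by (rule integral_kernel_pairing[OF fL vL])
  finally show ?thesis
    by (simp add: energy_eq[OF hf v] energy_eq[OF f hv])
qed

lemma bounded_K_op:
  assumes "dini_continuous h"
  shows "bounded_L2_operator M (K_op \<delta> M h)"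
    and "f \<in> L2_fun M \<Longrightarrow> AE x in M. set_integrable M (- {x}) (\<lambda>y. (h x - h y) / dist x y powr \<delta> * f y)"
proof -
  obtain B where B: "schur_kernel M (dini_kernel h) B" by (rule schur_kernel_dini[OF assms])
  interpret schur_kernel M "dini_kernel h" B by fact
  show "bounded_L2_operator M (K_op \<delta> M h)"
    unfolding K_op_eq_kernel_op[OF B] by (rule bounded_kernel_op)
  show "AE x in M. set_integrable M (- {x}) (\<lambda>y. (h x - h y) / dist x y powr \<delta> * f y)"
    if "f \<in> L2_fun M"
    unfolding set_integrable_def K_op_integrand by (rule AE_integrable_kernel[OF that])
qed

section \<open>The resolvent and its generator\<close>

text \<open>With \<open>f = R g\<close>, test \<open>\<langle>f, w\<rangle> + E(f, w) = \<langle>g, w\<rangle>\<close> against \<open>w = h v\<close> and move \<open>h\<close> to the left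
  in each term; only the energy term leaves a remainder, namely \<open>\<langle>K\<^sub>h f, v\<rangle>\<close>.\<close>

lemma resolvent_dini_mult:
  assumes h: "dini_continuous h" and g: "g \<in> L2_fun M" and f: "is_resolvent \<delta> M g f"
  shows "(\<lambda>x. h x * g x + K_op \<delta> M h f x) \<in> L2_fun M"
    and "is_resolvent \<delta> M (\<lambda>x. h x * g x + K_op \<delta> M h f x) (\<lambda>x. h x * f x)"
proof -
  obtain H where H: "\<And>x. \<bar>h x\<bar> \<le> H" using h by (auto simp: dini_continuous_def bounded_iff)
  have fE: "f \<in> dom_energy \<delta> M"
    and fg: "\<And>v. v \<in> dom_energy \<delta> M \<Longrightarrow> L2_inner M f v + energy \<delta> M f v = L2_inner M g v"
    using f by (auto simp: is_resolvent_def)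
  have hg: "(\<lambda>x. h x * g x) \<in> L2_fun M"
    by (rule L2_fun_bounded_mult[OF dini_measurable[OF h] H g])
  have Kf: "K_op \<delta> M h f \<in> L2_fun M"
    using bounded_K_op(1)[OF h] dom_energy_L2[OF fE] by (simp add: bounded_L2_operator_def)
  show "(\<lambda>x. h x * g x + K_op \<delta> M h f x) \<in> L2_fun M" by (rule L2_fun_add[OF hg Kf])
  show "is_resolvent \<delta> M (\<lambda>x. h x * g x + K_op \<delta> M h f x) (\<lambda>x. h x * f x)"
    unfolding is_resolvent_def
  proof (intro conjI ballI)
    show "(\<lambda>x. h x * f x) \<in> dom_energy \<delta> M" by (rule dom_energy_dini_mult[OF h fE])
    fix v assume v: "v \<in> dom_energy \<delta> M"
    have move: "L2_inner M (\<lambda>x. h x * u x) v = L2_inner M u (\<lambda>x. h x * v x)" for u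
      unfolding L2_inner_def by (simp add: mult_ac)
    have "L2_inner M (\<lambda>x. h x * f x) v + energy \<delta> M (\<lambda>x. h x * f x) v
        = L2_inner M g (\<lambda>x. h x * v x) + L2_inner M (K_op \<delta> M h f) v"
      unfolding energy_dini_mult[OF h fE v] move
      using fg[OF dom_energy_dini_mult[OF h v]] by simp
    also have "\<dots> = L2_inner M (\<lambda>x. h x * g x + K_op \<delta> M h f x) v"
      unfolding move[symmetric] unfolding L2_inner_def distrib_right
      by (intro Bochner_Integration.integral_add[symmetric] L2_fun_mult_integrable hg Kf dom_energy_L2 v)
    finally show "L2_inner M (\<lambda>x. h x * f x) v + energy \<delta> M (\<lambda>x. h x * f x) v
        = L2_inner M (\<lambda>x. h x * g x + K_op \<delta> M h f x) v" .
  qed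
qed

text \<open>Lipschitz functions are Dini continuous, hence multiply the constant \<open>1\<close> into the energy
  domain.  Orthogonality to all of them makes \<open>g - g'\<close> null.\<close>

lemma resolvent_source_unique:
  assumes g: "g \<in> L2_fun M" "is_resolvent \<delta> M g u" and g': "g' \<in> L2_fun M" "is_resolvent \<delta> M g' u"
  shows "AE x in M. g x = g' x"
proof -
  have one: "(\<lambda>x. 1) \<in> L2_fun M" by (rule bounded_in_L2_fun[where H = 1]) auto
  have "energy_density (\<lambda>x. 1) (\<lambda>x. 1) = (\<lambda>p. 0)" by (auto simp: energy_density_def)
  then have one_dom: "(\<lambda>x. 1) \<in> dom_energy \<delta> M" by (simp add: dom_energy_iff[OF one])
  have "AE x in M. g x - g' x = 0"
  proof (rule AE_zero_if_orthogonal_to_Lipschitz[OF finite_measure_axioms borel_sets])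
    show "integrable M (\<lambda>x. g x - g' x)"
      using L2_fun_mult_integrable[OF g(1) one] L2_fun_mult_integrable[OF g'(1) one] by simp
    fix v :: "'a \<Rightarrow> real" and L assume v: "L-lipschitz_on UNIV v" "\<And>x. 0 \<le> v x \<and> v x \<le> 1"
    have "bounded (range v)" unfolding bounded_iff using v(2) by (intro exI[of _ 1]) auto
    then have "dini_continuous v" by (rule Lipschitz_dini_continuous[OF bounded_space v(1)])
    from dom_energy_dini_mult[OF this one_dom] have vE: "v \<in> dom_energy \<delta> M" by simp
    then have "L2_inner M g v = L2_inner M g' v" using g(2) g'(2) by (simp add: is_resolvent_def)
    then show "(LINT x|M. (g x - g' x) * v x) = 0"
      using L2_fun_mult_integrable[OF g(1) dom_energy_L2[OF vE]]
        L2_fun_mult_integrable[OF g'(1) dom_energy_L2[OF vE]]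
      by (simp add: L2_inner_def left_diff_distrib)
  qed
  then show ?thesis by simp
qed

lemma log_laplacian_AE_eq:
  assumes "g \<in> L2_fun M" "is_resolvent \<delta> M g u"
  shows "AE x in M. log_laplacian \<delta> M u x = g x - u x"
proof -
  let ?s = "SOME f. f \<in> L2_fun M \<and> is_resolvent \<delta> M f u"
  have "?s \<in> L2_fun M \<and> is_resolvent \<delta> M ?s u"
    by (rule someI[of _ g]) (use assms in blast)
  then have "AE x in M. ?s x = g x" using resolvent_source_unique assms by blast
  then show ?thesis by (simp add: log_laplacian_def)
qed

lemma commutator_log_laplacian_dini:
  assumes h: "dini_continuous h" and f: "f \<in> dom_log_laplacian \<delta> M"
  shows "mult_op h f \<in> dom_log_laplacian \<delta> M"
    and "AE x in M. commutator (log_laplacian \<delta> M) (mult_op h) f x = K_op \<delta> M h f x"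
proof -
  obtain g where g: "g \<in> L2_fun M" "is_resolvent \<delta> M g f"
    using f by (auto simp: dom_log_laplacian_def)
  note hf = resolvent_dini_mult[OF h g]
  show "mult_op h f \<in> dom_log_laplacian \<delta> M"
    unfolding dom_log_laplacian_def mult_op_def using hf by blast
  show "AE x in M. commutator (log_laplacian \<delta> M) (mult_op h) f x = K_op \<delta> M h f x"
    using log_laplacian_AE_eq[OF hf] log_laplacian_AE_eq[OF g]
    by eventually_elim (simp add: commutator_def mult_op_def right_diff_distrib)
qed

end

section \<open>The commutator theorem\<close>

lemma upper_regular_space_if_ahlfors_regular:
  fixes \<mu> :: "'a::{metric_space, second_countable_topology} measure"
  assumes "\<delta> > 0" "metric_measure_space \<mu>" "ahlfors_regular \<delta> \<mu>"
  obtains C where "upper_regular_space \<mu> \<delta> C"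
proof -
  have fin: "finite_measure \<mu>" and borel: "sets \<mu> = sets borel"
    using assms(2) by (auto simp: metric_measure_space_def)
  note bdd = ahlfors_regular_bounded[OF assms(1) fin assms(3)]
  obtain C where C: "0 \<le> C" "\<And>x r. 0 < diameter (UNIV :: 'a set) \<Longrightarrow> 0 < r \<Longrightarrow>
      measure \<mu> (cball x r) \<le> C * r powr \<delta>"
  proof (cases "0 < diameter (UNIV :: 'a set)")
    case True
    with ahlfors_regular_upper[OF assms(1) fin assms(3)] that show ?thesis by metis
  next
    case False
    then show ?thesis using that[of 0] by blast
  qed
  have "upper_regular_space \<mu> \<delta> C"
    using fin borel bdd C assms(1)
    by (simp add: upper_regular_space_def upper_regular_space_axioms_def)
  then show ?thesis by (rule that)
qed

theorem theorem4p9: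
  fixes \<mu> :: "'a::{metric_space, second_countable_topology} measure"
    and \<delta> :: real and h :: "'a \<Rightarrow> real"
  assumes "\<delta> > 0"
    and "metric_measure_space \<mu>"
    and "ahlfors_regular \<delta> \<mu>"
    and "dini_continuous h"
  shows "(\<forall>f\<in>dom_log_laplacian \<delta> \<mu>. mult_op h f \<in> dom_log_laplacian \<delta> \<mu>) \<and>
    (\<forall>f\<in>L2_fun \<mu>. AE x in \<mu>.
       set_integrable \<mu> (-{x}) (\<lambda>y. (h x - h y) / dist x y powr \<delta> * f y)) \<and>
    bounded_L2_operator \<mu> (K_op \<delta> \<mu> h) \<and>
    (\<forall>f\<in>dom_log_laplacian \<delta> \<mu>. AE x in \<mu>.
       commutator (log_laplacian \<delta> \<mu>) (mult_op h) f x = K_op \<delta> \<mu> h f x)"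
proof -
  obtain C where "upper_regular_space \<mu> \<delta> C"
    using upper_regular_space_if_ahlfors_regular assms(1-3) by blast
  then interpret upper_regular_space \<mu> \<delta> C .
  show ?thesis
    using commutator_log_laplacian_dini[OF assms(4)] bounded_K_op[OF assms(4)] by blast
qed

end
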